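(* The Stanley–Wilf limit of the pattern $1324$ is at most $16$, i.e. $L(1324)\le 16$.
   Context: A permutation $\pi=\pi_1\cdots\pi_n$ of $\{1,\dots,n\}$ contains a permutation (pattern) $\tau$ of length $k$ if there are indices $i_1<\cdots<i_k$ such that $\pi_{i_1}\cdots\pi_{i_k}$ is order-isomorphic to $\tau$; otherwise $\pi$ avoids $\tau$. Let $S_n(\tau)$ denote the number of permutations of length $n$ avoiding $\tau$. The Stanley–Wilf limit of $\tau$ is $L(\tau)=\lim_{n\to\infty} S_n(\tau)^{1/n}$ (this limit is known to exist and be finite for every pattern $\tau$). *)

theory Defs
  imports Complex_Main "HOL-Combinatorics.Multiset_Permutations"
begin

(* A permutation of {1..n} is written in one-line notation, as a list in
   permutations_of_set {1..n}; list positions count from 0. *)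

definition order_isomorphic :: "nat list \<Rightarrow> nat list \<Rightarrow> bool" where
  "order_isomorphic xs ys \<longleftrightarrow>
     length xs = length ys \<and>
     (\<forall>a<length xs. \<forall>b<length xs. xs ! a < xs ! b \<longleftrightarrow> ys ! a < ys ! b)"

definition contains_pattern :: "nat list \<Rightarrow> nat list \<Rightarrow> bool" where
  "contains_pattern p t \<longleftrightarrow>
     (\<exists>i :: nat \<Rightarrow> nat.
        strict_mono_on {..<length t} i \<and>
        (\<forall>j<length t. i j < length p) \<and>
        order_isomorphic (map (\<lambda>j. p ! i j) [0..<length t]) t)"

definition avoids_pattern :: "nat list \<Rightarrow> nat list \<Rightarrow> bool" where
  "avoids_pattern p t \<longleftrightarrow> \<not> contains_pattern p t"

definition num_avoiders :: "nat list \<Rightarrow> nat \<Rightarrow> nat" where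
  "num_avoiders t n = card {p \<in> permutations_of_set {1..n}. avoids_pattern p t}"

definition stanley_wilf_seq :: "nat list \<Rightarrow> nat \<Rightarrow> real" where
  "stanley_wilf_seq t n = root n (real (num_avoiders t n))"

(* The value of lim is meaningful only for a convergent sequence. *)
definition stanley_wilf_limit :: "nat list \<Rightarrow> real" where
  "stanley_wilf_limit t = lim (stanley_wilf_seq t)"

end

theory Submission
  imports Defs
begin

text \<open>
  The upper bound rests on an observation of Claesson, Jelinek and Steingrimsson: the entries of a
  1324-avoiding permutation can be coloured red and blue so that the red entries avoid 132 and
  the blue entries avoid 213. The colouring is greedy from left to right: an entry becomes blue
  when red would complete a red 132, or when a smaller blue entry precedes it.
  Suppose that the blue entries contained 213. A red 1 and a red 3 caused its lowest entry, or a
  blue one below and before that, to be blue. If this red 1 precedes the 213, the four entries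
  form 1324. Otherwise the red 1 and 3, the entry that they made blue, and the largest entry of the
  213 form 1324 (\<open>blue_avoids_213\<close>).

  A 132-avoiding arrangement of given values is determined by the positions and the values of its
  left-to-right minima: at each other position stands the smallest unused value above the current
  minimum (\<open>avoids_132_unique\<close>). Reversing both the order of positions and the order of values
  turns 132 into 213 and left-to-right minima into right-to-left maxima. Hence a 1324-avoider is
  determined by four subsets of n-element sets: the positions and the values of the blue
  entries, and the positions and the values of the extremal entries, where the
  red minima and the blue maxima can share one set because the colours tell them apart.
  This leaves at most \<open>(2 ^ n) ^ 4 = 16 ^ n\<close> permutations (\<open>num_avoiders_1324_le\<close>).

  The n-th roots converge by Fekete's argument. Placing one avoider above and to the left of
  another creates no 1324, because 1324 does not split into a high left part and a low right part;
  so the counts are supermultiplicative (\<open>num_avoiders_1324_supermult\<close>), their logarithms are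
  superadditive, and the bound just described gives them linear growth.
\<close>

section \<open>Patterns as conditions on positions\<close>

lemma contains_1324_iff:
  "contains_pattern p [1, 3, 2, 4] \<longleftrightarrow>
     (\<exists>a b c d. a < b \<and> b < c \<and> c < d \<and> d < length p \<and>
        p ! a < p ! c \<and> p ! c < p ! b \<and> p ! b < p ! d)" (is "?L \<longleftrightarrow> ?R")
proof
  assume ?L
  then obtain i where i: "strict_mono_on {..<4::nat} i" "\<forall>j<4. i j < length p"
    and iso: "order_isomorphic (map (\<lambda>j. p ! i j) [0..<4]) [1, 3, 2, 4]"
    unfolding contains_pattern_def by (auto simp: numeral_eq_Suc)
  have "i 0 < i 1" "i 1 < i 2" "i 2 < i 3"
    using i(1) by (auto simp: strict_mono_on_def)
  moreover have "i 3 < length p" using i(2) by simp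
  moreover have "p ! i a < p ! i b \<longleftrightarrow> [1, 3, 2, 4::nat] ! a < [1, 3, 2, 4] ! b"
    if "a < 4" "b < 4" for a b
    using iso that unfolding order_isomorphic_def by auto
  from this[of 0 2] this[of 2 1] this[of 1 3]
  have "p ! i 0 < p ! i 2" "p ! i 2 < p ! i 1" "p ! i 1 < p ! i 3"
    by (simp_all add: numeral_eq_Suc)
  ultimately show ?R by blast
next
  assume ?R
  then obtain a b c d where *: "a < b" "b < c" "c < d" "d < length p"
    "p ! a < p ! c" "p ! c < p ! b" "p ! b < p ! d" by blast
  define i where "i = (\<lambda>j. [a, b, c, d] ! j)"
  have "strict_mono_on {..<4} i"
    using * by (auto simp: strict_mono_on_def i_def numeral_eq_Suc less_Suc_eq)
  moreover have "\<forall>j<4. i j < length p"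
    using * by (auto simp: i_def numeral_eq_Suc less_Suc_eq)
  moreover have "order_isomorphic (map (\<lambda>j. p ! i j) [0..<4]) [1, 3, 2, 4]"
    using * by (auto simp: order_isomorphic_def i_def numeral_eq_Suc less_Suc_eq)
  ultimately show ?L
    unfolding contains_pattern_def by (intro exI[of _ i]) (simp add: numeral_eq_Suc)
qed

section \<open>Splitting a 1324-avoider into a 132-avoider and a 213-avoider\<close>

\<comment> \<open>The congruence rule lets the termination proof see that the recursive calls are at smaller positions.\<close>
context notes conj_cong[fundef_cong] begin

text \<open>
  Positions that are not blue are red. The second disjunct keeps 132 out of the red entries. By
  the first, no red entry after a blue entry lies above it; this bounds the red 3
  in the proof that the blue entries avoid 213.
\<close>
function blue :: "(nat \<Rightarrow> nat) \<Rightarrow> nat \<Rightarrow> bool" where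
  "blue f k \<longleftrightarrow>
     (\<exists>j. j < k \<and> blue f j \<and> f j < f k) \<or>
     (\<exists>i j. i < j \<and> j < k \<and> \<not> blue f i \<and> \<not> blue f j \<and> f i < f k \<and> f k < f j)"
  by pat_completeness auto
termination by (relation "measure snd") auto

end

declare blue.simps [simp del]

text \<open>
  Following smaller blue entries to the left ends at an entry \<open>h\<close> that is blue by the second
  disjunct, so it plays the 2 in a 132 whose other entries are red.
\<close>
lemma blue_witness:
  assumes "blue f k"
  shows "\<exists>h i j. i < j \<and> j < h \<and> h \<le> k \<and> \<not> blue f i \<and> \<not> blue f j \<and>
    f i < f h \<and> f h < f j \<and> f h \<le> f k"
  using assms
proof (induction k rule: less_induct)
  case (less k)
  consider j where "j < k" "blue f j" "f j < f k"
    | i j where "i < j" "j < k" "\<not> blue f i" "\<not> blue f j" "f i < f k" "f k < f j"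
    using less.prems unfolding blue.simps[of f k] by blast
  then show ?case
  proof cases
    case 1
    obtain h i l where "i < l" "l < h" "h \<le> j" "\<not> blue f i" "\<not> blue f l"
      "f i < f h" "f h < f l" "f h \<le> f j"
      using less.IH[OF 1(1,2)] by blast
    moreover have "h \<le> k" "f h \<le> f k" using calculation 1 by linarith+
    ultimately show ?thesis by blast
  next
    case 2
    then show ?thesis using less_imp_le order_refl by metis
  qed
qed

lemma red_avoids_132:
  assumes "i < j" "j < k" "\<not> blue f i" "\<not> blue f j" "\<not> blue f k"
  shows "\<not> (f i < f k \<and> f k < f j)"
  using assms unfolding blue.simps[of f k] by blast

text \<open>
  Suppose that there is a 213 at \<open>x < y < z\<close>, and take the 132 at \<open>i < j < h\<close>, red at \<open>i\<close> and \<open>j\<close>,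
  that lies behind the colour of \<open>y\<close>. If \<open>i\<close> precedes \<open>x\<close>, its value is
  low enough to put a 1 in front of the 213. Otherwise \<open>j\<close> is red and comes after the blue \<open>x\<close>,
  so its value does not exceed that of \<open>x\<close>, which is below that of \<open>z\<close>, and \<open>z\<close> puts a 4 behind
  the 132.
\<close>
lemma blue_avoids_213:
  assumes avoid: "\<And>a b c d. a < b \<Longrightarrow> b < c \<Longrightarrow> c < d \<Longrightarrow> d < n \<Longrightarrow>
      f a < f c \<Longrightarrow> f c < f b \<Longrightarrow> f b < f d \<Longrightarrow> False"
    and x: "x < y" "y < z" "z < n" "blue f x" "blue f y"
  shows "\<not> (f y < f x \<and> f x < f z)"
proof
  assume v: "f y < f x \<and> f x < f z"
  obtain h i j where w: "i < j" "j < h" "h \<le> y" "\<not> blue f i" "\<not> blue f j"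
    "f i < f h" "f h < f j" "f h \<le> f y"
    using blue_witness[OF x(5)] by blast
  show False
  proof (cases "i < x")
    case True
    then show False using avoid[of i x y z] w v x by linarith
  next
    case False
    moreover have "i \<noteq> x" using x(4) w(4) by auto
    ultimately have "x < j" using w(1) by simp
    then have "\<not> f x < f j"
      using x(4) w(5) by (metis blue.simps)
    then show False using avoid[of i j h z] w v x by linarith
  qed
qed

section \<open>Reconstruction from extremal entries\<close>

text \<open>
  Positions and values are taken from one linear order, so that passing to the dual order
  reverses both at once; this is how 213 is obtained from 132 below.
\<close>
context linorder begin

definition avoids_132_on :: "('a \<Rightarrow> 'a) \<Rightarrow> 'a set \<Rightarrow> bool" where
  "avoids_132_on f P \<longleftrightarrow> (\<forall>i\<in>P. \<forall>j\<in>P. \<forall>k\<in>P.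
     i < j \<longrightarrow> j < k \<longrightarrow> \<not> (f i < f k \<and> f k < f j))"

definition lr_minima :: "('a \<Rightarrow> 'a) \<Rightarrow> 'a set \<Rightarrow> 'a set" where
  "lr_minima f P = {k \<in> P. \<forall>j\<in>P. j < k \<longrightarrow> f k < f j}"

text \<open>
  The inductive step of the reconstruction, for one of the two possible signs of a discrepancy at
  the first position \<open>k\<close> where \<open>f\<close> and \<open>g\<close> might differ.
  If \<open>k\<close> is a minimum, then the larger value \<open>g k\<close> is a minimum of \<open>f\<close> that comes later
  than the smaller minimum \<open>f k\<close>, but minima decrease. If it is not, then \<open>g\<close> takes the value \<open>f k\<close> later, after a smaller
  value before \<open>k\<close> and the larger value at \<open>k\<close>, which is a 132.
\<close>
lemma avoids_132_step:
  assumes "inj_on f P" "inj_on g P" "f ` P = g ` P" "avoids_132_on g P"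
    and lr: "lr_minima f P = lr_minima g P" "f ` lr_minima f P = g ` lr_minima g P"
    and k: "k \<in> P" "\<And>j. j \<in> P \<Longrightarrow> j < k \<Longrightarrow> f j = g j"
  shows "\<not> f k < g k"
proof
  assume lt: "f k < g k"
  show False
  proof (cases "k \<in> lr_minima f P")
    case True
    then have "g k \<in> f ` lr_minima f P" unfolding lr(2) unfolding lr(1) by (rule imageI)
    then obtain l where l: "l \<in> lr_minima f P" "f l = g k" by auto
    then have "l \<in> P" by (simp add: lr_minima_def)
    have "l \<noteq> k" using l lt by auto
    moreover have False if "l < k"
      using inj_onD[OF \<open>inj_on g P\<close>, of l k] k(2)[OF \<open>l \<in> P\<close> that] l k(1) \<open>l \<in> P\<close> \<open>l \<noteq> k\<close> by simp
    ultimately have "k < l" by (meson neqE)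
    then have "f l < f k" using l(1) k(1) by (simp add: lr_minima_def)
    then show False using l lt by simp
  next
    case False
    then obtain j where j: "j \<in> P" "j < k" "\<not> f k < f j"
      using k(1) by (auto simp: lr_minima_def)
    have "f j \<noteq> f k" using inj_onD[OF \<open>inj_on f P\<close>, of j k] j k(1) by auto
    then have "g j < f k" using j k(2)[OF j(1,2)] by auto
    have "f k \<in> g ` P" using \<open>f ` P = g ` P\<close> k(1) by blast
    then obtain l where l: "l \<in> P" "g l = f k" by auto
    have "l \<noteq> k" using l lt by auto
    moreover have False if "l < k"
      using inj_onD[OF \<open>inj_on f P\<close>, of l k] k(2)[OF l(1) that] l k(1) \<open>l \<noteq> k\<close> by simp
    ultimately have "k < l" by (meson neqE)
    then show False
      using \<open>avoids_132_on g P\<close> j(1,2) k(1) l lt \<open>g j < f k\<close> unfolding avoids_132_on_def by fastforce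
  qed
qed

lemma avoids_132_unique:
  assumes "finite P" "inj_on f P" "inj_on g P" "f ` P = g ` P"
    and "avoids_132_on f P" "avoids_132_on g P"
    and "lr_minima f P = lr_minima g P" "f ` lr_minima f P = g ` lr_minima g P"
    and "k \<in> P"
  shows "f k = g k"
proof (rule ccontr)
  assume "f k \<noteq> g k"
  define D where "D = {k \<in> P. f k \<noteq> g k}"
  have "finite D" "D \<noteq> {}" using assms \<open>f k \<noteq> g k\<close> by (auto simp: D_def)
  define m where "m = Min D"
  have m: "m \<in> P" "f m \<noteq> g m"
    using Min_in[OF \<open>finite D\<close> \<open>D \<noteq> {}\<close>] by (auto simp: m_def D_def)
  have before: "f j = g j" if "j \<in> P" "j < m" for j
    using that Min_le[OF \<open>finite D\<close>, of j] by (fastforce simp: m_def D_def)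
  have "\<not> f m < g m"
    using avoids_132_step[OF assms(2,3,4,6,7,8) m(1)] before by blast
  moreover have "\<not> g m < f m"
    using avoids_132_step[OF assms(3,2) assms(4)[symmetric] assms(5)
        assms(7)[symmetric] assms(8)[symmetric] m(1)] before by metis
  ultimately show False using m by simp
qed

end

definition rl_maxima :: "(nat \<Rightarrow> nat) \<Rightarrow> nat set \<Rightarrow> nat set" where
  "rl_maxima f P = {k \<in> P. \<forall>j\<in>P. k < j \<longrightarrow> f j < f k}"

lemma avoids_213_unique:
  fixes f g :: "nat \<Rightarrow> nat"
  assumes "finite P" "inj_on f P" "inj_on g P" "f ` P = g ` P"
    and "\<And>i j k. \<lbrakk>i \<in> P; j \<in> P; k \<in> P; i < j; j < k\<rbrakk> \<Longrightarrow> \<not> (f j < f i \<and> f i < f k)"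
    and "\<And>i j k. \<lbrakk>i \<in> P; j \<in> P; k \<in> P; i < j; j < k\<rbrakk> \<Longrightarrow> \<not> (g j < g i \<and> g i < g k)"
    and "rl_maxima f P = rl_maxima g P" "f ` rl_maxima f P = g ` rl_maxima g P"
    and "k \<in> P"
  shows "f k = g k"
proof -
  have eq: "linorder.lr_minima (\<lambda>x y. y < x) h P = rl_maxima h P" for h :: "nat \<Rightarrow> nat"
    unfolding linorder.lr_minima_def[OF dual_linorder] rl_maxima_def ..
  show ?thesis
    by (rule linorder.avoids_132_unique[OF dual_linorder, of P f g k])
      (use assms in \<open>auto simp: eq linorder.avoids_132_on_def[OF dual_linorder]\<close>)
qed

section \<open>At most 16 to the n avoiders\<close>

definition blue_positions :: "nat list \<Rightarrow> nat set" where
  "blue_positions p = {k. k < length p \<and> blue ((!) p) k}"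

definition red_positions :: "nat list \<Rightarrow> nat set" where
  "red_positions p = {k. k < length p \<and> \<not> blue ((!) p) k}"

text \<open>
  One set holds both kinds of extremal positions; the colours separate it again.
\<close>
definition extremal_positions :: "nat list \<Rightarrow> nat set" where
  "extremal_positions p =
     lr_minima ((!) p) (red_positions p) \<union> rl_maxima ((!) p) (blue_positions p)"

definition extremal_code :: "nat list \<Rightarrow> (nat set \<times> nat set) \<times> nat set \<times> nat set" where
  "extremal_code p = ((blue_positions p, (!) p ` blue_positions p),
             (extremal_positions p, (!) p ` extremal_positions p))"

definition avoiders :: "nat list \<Rightarrow> nat \<Rightarrow> nat list set" where
  "avoiders t n = {p \<in> permutations_of_set {1..n}. avoids_pattern p t}"

lemma avoiders_props:
  assumes "p \<in> avoiders t n"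
  shows "length p = n" "distinct p" "set p = {1..n}"
  using assms length_finite_permutations_of_set[of p "{1..n}"]
  by (auto simp: avoiders_def permutations_of_set_def)

lemma inj_on_extremal_code: "inj_on extremal_code (avoiders [1, 3, 2, 4] n)"
proof (rule inj_onI)
  fix p q assume p: "p \<in> avoiders [1, 3, 2, 4] n" and q: "q \<in> avoiders [1, 3, 2, 4] n"
    and eq: "extremal_code p = extremal_code q"
  note pp = avoiders_props[OF p] and qq = avoiders_props[OF q]
  define B where "B = blue_positions p"
  define R where "R = {..<n} - B"
  have BR: "blue_positions x = B" "red_positions x = R" if "x = p \<or> x = q" for x
    using that eq pp qq
    by (auto simp: B_def R_def extremal_code_def blue_positions_def red_positions_def)
  have sub: "B \<subseteq> {..<n}" "R \<subseteq> {..<n}" "R \<inter> B = {}" "R \<union> B = {..<n}"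
    using pp by (auto simp: B_def R_def blue_positions_def)
  have inj: "inj_on ((!) x) {..<n}" if "x = p \<or> x = q" for x
    using that pp qq by (auto simp: inj_on_nth)
  have rng: "(!) x ` {..<n} = {1..n}" if "x = p \<or> x = q" for x
    using that pp qq by (auto simp: set_conv_nth image_def)
  have valB: "(!) p ` B = (!) q ` B"
    using eq BR[of q] by (simp add: extremal_code_def B_def)
  have valR: "(!) x ` R = {1..n} - (!) x ` B" if "x = p \<or> x = q" for x
    using inj_on_image_set_diff[OF inj[OF that], of "{..<n}" B] rng[OF that] sub
    by (auto simp: R_def)
  have lrsub: "lr_minima f R \<subseteq> R" "rl_maxima f B \<subseteq> B" for f
    by (auto simp: lr_minima_def rl_maxima_def)
  define X where "X = extremal_positions p"
  have X: "lr_minima ((!) x) R \<union> rl_maxima ((!) x) B = X" if "x = p \<or> x = q" for x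
    using that eq BR by (auto simp: X_def extremal_code_def extremal_positions_def)
  \<comment> \<open>The common code splits along the colours: by position directly, by value through injectivity.\<close>
  have minX: "lr_minima ((!) x) R = X \<inter> R" and maxX: "rl_maxima ((!) x) B = X \<inter> B"
    if "x = p \<or> x = q" for x
    using X[OF that] lrsub[of "(!) x"] sub(3) by blast+
  have valX: "(!) p ` X = (!) q ` X"
    using eq unfolding extremal_code_def X_def by simp metis
  have Xn: "X \<subseteq> {..<n}" using X[of p] lrsub[of "(!) p"] sub(1,2) by blast
  have valXB: "(!) x ` (X \<inter> B) = (!) x ` X \<inter> (!) x ` B"
    and valXR: "(!) x ` (X \<inter> R) = (!) x ` X \<inter> (!) x ` R" if "x = p \<or> x = q" for x
    using inj_on_image_Int[OF inj[OF that]] Xn sub by auto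
  have red: "avoids_132_on ((!) x) R" if "x = p \<or> x = q" for x
    unfolding avoids_132_on_def using red_avoids_132[of _ _ _ "(!) x"] BR[OF that]
    by (auto simp: red_positions_def)
  have blue: "\<not> (x ! j < x ! i \<and> x ! i < x ! k)"
    if "x = p \<or> x = q" "i \<in> B" "j \<in> B" "k \<in> B" "i < j" "j < k" for x i j k
  proof (rule blue_avoids_213[of n "(!) x" i j k])
    fix a b c d assume "a < b" "b < c" "c < d" "d < n" "x ! a < x ! c" "x ! c < x ! b" "x ! b < x ! d"
    moreover have "length x = n" using that(1) pp(1) qq(1) by auto
    ultimately have "contains_pattern x [1, 3, 2, 4]"
      unfolding contains_1324_iff by blast
    moreover have "avoids_pattern x [1, 3, 2, 4]"
      using that(1) p q unfolding avoiders_def by auto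
    ultimately show False by (simp add: avoids_pattern_def)
  next
    have "i \<in> blue_positions x" "j \<in> blue_positions x"
      using that(2,3) BR(1)[OF that(1)] by simp_all
    then show "blue ((!) x) i" "blue ((!) x) j"
      by (simp_all add: blue_positions_def)
    show "k < n" using that(4) sub(1) by auto
  qed (fact that)+
  have P: "p = p \<or> p = q" and Q: "q = p \<or> q = q" by simp_all
  have fin: "finite R" "finite B" using sub(1,2) finite_subset by blast+
  have "p ! k = q ! k" if "k \<in> R" for k
  proof (rule avoids_132_unique[OF fin(1) _ _ _ red[OF P] red[OF Q] _ _ that])
    show "inj_on ((!) p) R" "inj_on ((!) q) R"
      by (rule inj_on_subset[OF inj[OF P] sub(2)], rule inj_on_subset[OF inj[OF Q] sub(2)])
    show valR_eq: "(!) p ` R = (!) q ` R"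
      unfolding valR[OF P] valR[OF Q] valB ..
    show "lr_minima ((!) p) R = lr_minima ((!) q) R"
      unfolding minX[OF P] minX[OF Q] ..
    show "(!) p ` lr_minima ((!) p) R = (!) q ` lr_minima ((!) q) R"
      unfolding minX[OF P] minX[OF Q] valXR[OF P] valXR[OF Q] valX valR_eq ..
  qed
  moreover have "p ! k = q ! k" if "k \<in> B" for k
  proof (rule avoids_213_unique[OF fin(2) _ _ valB blue[OF P] blue[OF Q] _ _ that])
    show "inj_on ((!) p) B" "inj_on ((!) q) B"
      by (rule inj_on_subset[OF inj[OF P] sub(1)], rule inj_on_subset[OF inj[OF Q] sub(1)])
    show "rl_maxima ((!) p) B = rl_maxima ((!) q) B"
      unfolding maxX[OF P] maxX[OF Q] ..
    show "(!) p ` rl_maxima ((!) p) B = (!) q ` rl_maxima ((!) q) B"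
      unfolding maxX[OF P] maxX[OF Q] valXB[OF P] valXB[OF Q] valX valB ..
  qed
  moreover have "k \<in> R \<or> k \<in> B" if "k < n" for k using that sub(4) by auto
  ultimately show "p = q"
    using pp(1) qq(1) by (intro nth_equalityI) auto
qed

lemma num_avoiders_1324_le: "num_avoiders [1, 3, 2, 4] n \<le> 16 ^ n"
proof -
  let ?A = "avoiders [1, 3, 2, 4] n"
  let ?C = "(Pow {..<n} \<times> Pow {1..n}) \<times> Pow {..<n} \<times> Pow {1..n}"
  have "extremal_code ` ?A \<subseteq> ?C"
  proof (rule image_subsetI)
    fix p assume "p \<in> ?A"
    note pp = avoiders_props[OF this]
    have "blue_positions p \<subseteq> {..<n}" "extremal_positions p \<subseteq> {..<n}"
      using pp by (auto simp: blue_positions_def red_positions_def extremal_positions_def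
          lr_minima_def rl_maxima_def)
    moreover have "p ! k \<in> {1..n}" if "k < n" for k
      using pp that nth_mem by blast
    ultimately show "extremal_code p \<in> ?C" unfolding extremal_code_def by blast
  qed
  then have "card ?A \<le> card ?C"
    by (intro card_inj_on_le[OF inj_on_extremal_code]) auto
  also have "card ?C = (2 ^ n * 2 ^ n) * (2 ^ n * 2 ^ n)"
    by (simp add: card_cartesian_product card_Pow)
  also have "\<dots> = 16 ^ n"
    by (simp flip: power_mult_distrib)
  finally show ?thesis by (simp add: num_avoiders_def avoiders_def)
qed

section \<open>Supermultiplicativity\<close>

text \<open>
  The skew sum of an avoider of length \<open>m\<close> and one of length \<open>n\<close> avoids 1324. If the 1 of an
  occurrence lies in the left block, its value exceeds \<open>n\<close>, so the value of the 4 does too and the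
  whole occurrence lies in the left block; otherwise all of it lies in the right block.
\<close>
lemma num_avoiders_1324_supermult:
  "num_avoiders [1, 3, 2, 4] m * num_avoiders [1, 3, 2, 4] n \<le> num_avoiders [1, 3, 2, 4] (m + n)"
proof -
  let ?A = "avoiders [1, 3, 2, 4]"
  define skew :: "nat list \<times> nat list \<Rightarrow> nat list"
    where "skew = (\<lambda>(p, q). map (\<lambda>x. x + n) p @ q)"
  have "inj_on skew (?A m \<times> ?A n)"
  proof (rule inj_onI, clarify)
    fix p q p' q' assume *: "p \<in> ?A m" "p' \<in> ?A m" and eq: "skew (p, q) = skew (p', q')"
    have "length p = length p'" using avoiders_props(1) * by metis
    then show "p = p' \<and> q = q'"
      using eq by (auto simp: skew_def inj_map_eq_map)
  qed
  moreover have "skew ` (?A m \<times> ?A n) \<subseteq> ?A (m + n)"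
  proof clarify
    fix p q assume p: "p \<in> ?A m" and q: "q \<in> ?A n"
    note pp = avoiders_props[OF p] and qq = avoiders_props[OF q]
    let ?s = "skew (p, q)"
    have "(\<lambda>x. x + n) ` {1..m} = {n + 1..m + n}"
      using image_add_atLeastAtMost'[of n 1 m] by (simp add: add.commute)
    then have "set ?s = {1..m + n}" "distinct ?s"
      using pp qq by (auto simp: skew_def distinct_map)
    moreover have "\<not> contains_pattern ?s [1, 3, 2, 4]"
    proof
      assume "contains_pattern ?s [1, 3, 2, 4]"
      then obtain a b c d where *: "a < b" "b < c" "c < d" "d < length ?s"
        "?s ! a < ?s ! c" "?s ! c < ?s ! b" "?s ! b < ?s ! d"
        unfolding contains_1324_iff by blast
      have len: "length ?s = m + n" using pp qq by (simp add: skew_def)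
      have hi: "?s ! i = p ! i + n" if "i < m" for i
        using that pp by (simp add: skew_def nth_append)
      have lo: "?s ! i = q ! (i - m)" "?s ! i \<le> n" if "m \<le> i" "i < m + n" for i
      proof -
        show e: "?s ! i = q ! (i - m)" using that pp by (simp add: skew_def nth_append)
        have "q ! (i - m) \<in> set q" using that qq by auto
        then show "?s ! i \<le> n" using e qq by auto
      qed
      show False
      proof (cases "a < m")
        case True
        then have "n < ?s ! d" using hi[of a] * pp by linarith
        then have "d < m" using lo(2)[of d] * len by linarith
        then have "contains_pattern p [1, 3, 2, 4]"
          unfolding contains_1324_iff using * hi pp
          by (intro exI[of _ a] exI[of _ b] exI[of _ c] exI[of _ d]) auto
        then show False using p by (simp add: avoiders_def avoids_pattern_def)
      next
        case False
        then have "contains_pattern q [1, 3, 2, 4]"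
          unfolding contains_1324_iff using * lo len qq
          by (intro exI[of _ "a - m"] exI[of _ "b - m"] exI[of _ "c - m"] exI[of _ "d - m"]) auto
        then show False using q by (simp add: avoiders_def avoids_pattern_def)
      qed
    qed
    ultimately show "?s \<in> ?A (m + n)"
      by (simp add: avoiders_def avoids_pattern_def permutations_of_set_def)
  qed
  ultimately have "card (?A m \<times> ?A n) \<le> card (?A (m + n))"
    by (intro card_inj_on_le) (auto simp: avoiders_def)
  then show ?thesis by (simp add: card_cartesian_product num_avoiders_def avoiders_def)
qed

lemma num_avoiders_1324_pos: "1 \<le> num_avoiders [1, 3, 2, 4] n"
proof (induction n)
  case 0
  have "\<not> contains_pattern [] [1, 3, 2, 4]" unfolding contains_1324_iff by simp
  then show ?case by (simp add: num_avoiders_def avoids_pattern_def Suc_le_eq card_gt_0_iff)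
next
  case (Suc n)
  have "\<not> contains_pattern [1] [1, 3, 2, 4]" unfolding contains_1324_iff by simp
  then have "[1] \<in> {p \<in> permutations_of_set {1..1}. avoids_pattern p [1, 3, 2, 4]}"
    by (simp add: avoids_pattern_def)
  then have "1 \<le> num_avoiders [1, 3, 2, 4] 1"
    unfolding num_avoiders_def by (subst Suc_le_eq[of 0, folded One_nat_def]) (auto simp: card_gt_0_iff)
  then have "1 * 1 \<le> num_avoiders [1, 3, 2, 4] 1 * num_avoiders [1, 3, 2, 4] n"
    using Suc by (rule mult_le_mono)
  also have "\<dots> \<le> num_avoiders [1, 3, 2, 4] (Suc n)"
    using num_avoiders_1324_supermult[of 1 n] by simp
  finally show ?case by simp
qed

section \<open>Convergence and the bound on the limit\<close>

text \<open>
  Fekete's lemma for nonnegative sequences. Division of \<open>n\<close> by \<open>m\<close> with remainder gives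
  \<open>a n / n \<ge> a m / m - a m / n\<close>: for large \<open>n\<close> the quotients are almost as large as any one of
  them, and hence converge to their supremum.
\<close>
lemma superadditive_quotient_convergent:
  fixes a :: "nat \<Rightarrow> real" and C :: real
  assumes super: "\<And>m n. a m + a n \<le> a (m + n)"
    and nonneg: "\<And>n. 0 \<le> a n"
    and bound: "\<And>n. a n \<le> C * n"
  shows "convergent (\<lambda>n. a n / n)"
proof -
  have mult: "real q * a m + a r \<le> a (q * m + r)" for q m r
  proof (induction q)
    case (Suc q)
    then show ?case using super[of m "q * m + r"] by (simp add: algebra_simps)
  qed simp
  have lower: "a m / m - a m / n \<le> a n / n" if "0 < m" "0 < n" for m n
  proof -
    have "n \<le> (n div m + 1) * m"
      using dividend_less_div_times[of m n] that by simp
    then have "real n \<le> real ((n div m + 1) * m)" by (rule of_nat_mono)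
    then have "real n / m - 1 \<le> real (n div m)" using that by (simp add: field_simps)
    then have "(real n / m - 1) * a m \<le> real (n div m) * a m"
      using nonneg by (rule mult_right_mono)
    also have "\<dots> \<le> a n"
      using mult[of "n div m" m "n mod m"] nonneg[of "n mod m"] by simp
    finally have "(real n / m - 1) * a m / n \<le> a n / n" by (rule divide_right_mono) simp
    moreover have "(real n / m - 1) * a m / n = a m / m - a m / n"
      using that by (simp add: field_simps)
    ultimately show ?thesis by simp
  qed
  define L where "L = (SUP n\<in>{1..}. a n / n)"
  have bdd: "bdd_above ((\<lambda>n. a n / real n) ` {1..})"
    using bound by (intro bdd_aboveI2[of _ _ C]) (simp add: field_simps)
  have "(\<lambda>n. a n / n) \<longlonglongrightarrow> L"
  proof (rule LIMSEQ_I)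
    fix e :: real assume "0 < e"
    then have "L - e / 2 < L" by simp
    then obtain m where m: "1 \<le> m" "L - e / 2 < a m / m"
      using less_cSUP_iff[OF _ bdd, of "L - e / 2", folded L_def] by auto
    obtain N :: nat where N: "2 * a m / e < N" using reals_Archimedean2 by blast
    show "\<exists>N. \<forall>n\<ge>N. norm (a n / n - L) < e"
    proof (intro exI allI impI)
      fix n assume n: "Suc N \<le> n"
      then have "2 * a m / e < n" using N by linarith
      then have "a m / n < e / 2" using \<open>0 < e\<close> n by (simp add: field_simps)
      then have "L - e < a n / n" using lower[of m n] m n by linarith
      moreover have "a n / n \<le> L"
        unfolding L_def using n by (intro cSUP_upper bdd) auto
      ultimately show "norm (a n / n - L) < e" using \<open>0 < e\<close> by simp
    qed
  qed
  then show ?thesis by (rule convergentI)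
qed

theorem corollary5:
  shows "convergent (stanley_wilf_seq [1, 3, 2, 4]) \<and> stanley_wilf_limit [1, 3, 2, 4] \<le> 16"
proof -
  let ?s = "stanley_wilf_seq [1, 3, 2, 4]"
  define a where "a n = ln (real (num_avoiders [1, 3, 2, 4] n))" for n
  have pos: "0 < real (num_avoiders [1, 3, 2, 4] n)" for n
    using num_avoiders_1324_pos[of n] by simp
  have bound: "real (num_avoiders [1, 3, 2, 4] n) \<le> 16 ^ n" for n
    using of_nat_mono[OF num_avoiders_1324_le[of n], where 'a = real] by simp
  have "convergent (\<lambda>n. a n / n)"
  proof (rule superadditive_quotient_convergent)
    fix m n
    have "real (num_avoiders [1, 3, 2, 4] m) * real (num_avoiders [1, 3, 2, 4] n)
        \<le> real (num_avoiders [1, 3, 2, 4] (m + n))"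
      using num_avoiders_1324_supermult by (simp flip: of_nat_mult)
    then show "a m + a n \<le> a (m + n)"
      unfolding a_def using pos by (simp flip: ln_mult_pos)
    show "0 \<le> a n" using num_avoiders_1324_pos[of n] by (simp add: a_def)
    have "a n \<le> ln (16 ^ n)" using pos bound by (simp add: a_def)
    then show "a n \<le> ln 16 * n" by (simp add: ln_realpow mult.commute)
  qed
  then obtain l where "(\<lambda>n. a n / n) \<longlonglongrightarrow> l" by (auto simp: convergent_def)
  then have "(\<lambda>n. exp (a n / n)) \<longlonglongrightarrow> exp l" by (rule tendsto_exp)
  moreover have "\<forall>\<^sub>F n in sequentially. exp (a n / n) = ?s n"
    using eventually_gt_at_top[of 0]
  proof eventually_elim
    case (elim n)
    then show ?case
      using pos[of n] by (simp add: stanley_wilf_seq_def a_def root_powr_inverse powr_def)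
  qed
  ultimately have lim: "?s \<longlonglongrightarrow> exp l" by (rule Lim_transform_eventually)
  have "?s n \<le> 16" if "1 \<le> n" for n
  proof -
    have "?s n \<le> root n (16 ^ n)"
      unfolding stanley_wilf_seq_def using that bound by simp
    then show ?thesis using that by (simp add: real_root_power_cancel)
  qed
  then have "exp l \<le> 16" using LIMSEQ_le_const2[OF lim] by blast
  then show ?thesis using lim by (auto simp: stanley_wilf_limit_def convergent_def limI)
qed

end
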